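(* Let $A\in\mathcal S^n$ be a real symmetric matrix whose support graph $G(A)$ is a cycle (on the $n$ vertices $\{1,\dots,n\}$). Then $A\in\mathcal{CS}_+^n$ if and only if $A\in\mathcal{CP}^n$.
   Context: $\mathcal S^d$ denotes the real symmetric $d\times d$ matrices with trace inner product $\langle X,Y\rangle=\mathrm{Tr}(XY)$, and $\mathcal S^d_+$ the positive semidefinite ones. The support graph $G(A)$ of $A\in\mathcal S^n$ has vertex set $\{1,\dots,n\}$ and an edge $\{i,j\}$ ($i\ne j$) exactly when $A_{ij}\neq0$. $\mathcal{CS}_+^n$ (completely positive semidefinite matrices) is the set of $A\in\mathcal S^n$ for which there exist $d\ge1$ and $X_1,\dots,X_n\in\mathcal S^d_+$ with $A_{ij}=\langle X_i,X_j\rangle$ for all $i,j$. $\mathcal{CP}^n$ (completely positive matrices) is the set of $A\in\mathcal S^n$ for which there exist $d\ge1$ and entrywise nonnegative vectors $x_1,\dots,x_n\in\mathbb R^d_+$ with $A_{ij}=x_i^Tx_j$ for all $i,j$. *)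

theory Defs
  imports Complex_Main "Jordan_Normal_Form.Matrix"
begin

definition sym_mats :: "nat \<Rightarrow> real mat set" where
  "sym_mats d = {X \<in> carrier_mat d d. transpose_mat X = X}"

definition psd_mats :: "nat \<Rightarrow> real mat set" where
  "psd_mats d = {X \<in> sym_mats d. \<forall>v \<in> carrier_vec d. 0 \<le> v \<bullet> (X *\<^sub>v v)}"

definition mat_trace :: "real mat \<Rightarrow> real" where
  "mat_trace X = (\<Sum>i<dim_row X. X $$ (i, i))"

definition trace_inner :: "real mat \<Rightarrow> real mat \<Rightarrow> real" where
  "trace_inner X Y = mat_trace (X * Y)"

definition nonneg_vecs :: "nat \<Rightarrow> real vec set" where
  "nonneg_vecs d = {x \<in> carrier_vec d. \<forall>k<d. 0 \<le> x $ k}"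

text \<open>Rows and columns of a matrix of size \<open>n\<close> are numbered \<open>0, \<dots>, n - 1\<close>.\<close>

definition cs_plus :: "nat \<Rightarrow> real mat set" where
  "cs_plus n = {A \<in> sym_mats n. \<exists>d\<ge>1. \<exists>X :: nat \<Rightarrow> real mat.
     (\<forall>i<n. X i \<in> psd_mats d) \<and>
     (\<forall>i<n. \<forall>j<n. A $$ (i, j) = trace_inner (X i) (X j))}"

definition completely_positive :: "nat \<Rightarrow> real mat set" where
  "completely_positive n = {A \<in> sym_mats n. \<exists>d\<ge>1. \<exists>x :: nat \<Rightarrow> real vec.
     (\<forall>i<n. x i \<in> nonneg_vecs d) \<and>
     (\<forall>i<n. \<forall>j<n. A $$ (i, j) = x i \<bullet> x j)}"

text \<open>A simple graph is a pair of a vertex set and a set of two-element edges.\<close>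

type_synonym 'a simple_graph = "'a set \<times> 'a set set"

text \<open>The diagonal of the matrix plays no role in its support graph.\<close>

definition support_graph :: "nat \<Rightarrow> real mat \<Rightarrow> nat simple_graph" where
  "support_graph n A =
     ({0..<n}, {{i, j} | i j. i < n \<and> j < n \<and> i \<noteq> j \<and> A $$ (i, j) \<noteq> 0})"

text \<open>
  The whole graph is a cycle: for a suitable cyclic enumeration of all the vertices, of length
  at least 3, the edges are exactly the pairs of consecutive vertices, with no chords.
\<close>

definition is_cycle_graph :: "'a simple_graph \<Rightarrow> bool" where
  "is_cycle_graph G \<longleftrightarrow> (\<exists>vs. length vs \<ge> 3 \<and> distinct vs \<and> fst G = set vs \<and>
     snd G = {{vs ! k, vs ! (Suc k mod length vs)} | k. k < length vs})"

end

theory Submission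
  imports Defs
begin

text \<open>
  Replacing the off-diagonal entries of a nonnegative \<open>A\<close> by their negatives gives its comparison
  matrix. If that is positive semidefinite, there is a positive vector \<open>d\<close> whose image under it is
  nonnegative; then \<open>A\<close>, scaled by \<open>d\<close>, is diagonally dominant and hence completely positive.

  Let \<open>A\<close> be the Gram matrix of positive semidefinite \<open>X\<^sub>k\<close>. For nonadjacent vertices the trace of
  \<open>X\<^sub>k X\<^sub>l\<close> vanishes, so \<open>X\<^sub>k X\<^sub>l = 0\<close>. In an even cycle the matrices \<open>(-1)\<^sup>k X\<^sub>k\<close> have the comparison
  matrix of \<open>A\<close> as Gram matrix. In an odd cycle of length at least 5, the matrices at the two
  neighbours of vertex \<open>0\<close> have orthogonal ranges, and multiplying \<open>X\<^sub>0\<close> by an orthogonal matrix that negates one of these ranges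
  and fixes the other corrects the remaining sign. For the triangle, the comparison matrix need not
  be positive semidefinite; instead some \<open>2 \<times> 2\<close> Schur complement of \<open>A\<close> is entrywise nonnegative.
\<close>

section \<open>Positive semidefinite forms\<close>

text \<open>Arbitrary index sets let an induction eliminate one index without renumbering the
  others, and let vertices be relabelled along a cycle.\<close>

definition psd_form :: "'a set \<Rightarrow> ('a \<Rightarrow> 'a \<Rightarrow> real) \<Rightarrow> bool" where
  "psd_form I Q \<longleftrightarrow> (\<forall>i\<in>I. \<forall>j\<in>I. Q i j = Q j i) \<and>
     (\<forall>v. 0 \<le> (\<Sum>i\<in>I. \<Sum>j\<in>I. v i * v j * Q i j))"

lemma psd_form_sym: "psd_form I Q \<Longrightarrow> i \<in> I \<Longrightarrow> j \<in> I \<Longrightarrow> Q i j = Q j i"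
  by (auto simp: psd_form_def)

lemma psd_form_nonneg: "psd_form I Q \<Longrightarrow> 0 \<le> (\<Sum>i\<in>I. \<Sum>j\<in>I. v i * v j * Q i j)"
  by (auto simp: psd_form_def)

lemma psd_formI:
  assumes "\<And>i j. i \<in> I \<Longrightarrow> j \<in> I \<Longrightarrow> Q i j = Q j i"
    and "\<And>v. 0 \<le> (\<Sum>i\<in>I. \<Sum>j\<in>I. v i * v j * Q i j)"
  shows "psd_form I Q"
  using assms unfolding psd_form_def by blast

lemma psd_form_cong:
  assumes "\<And>i j. i \<in> I \<Longrightarrow> j \<in> I \<Longrightarrow> Q i j = R i j"
  shows "psd_form I Q \<longleftrightarrow> psd_form I R"
  using assms by (simp add: psd_form_def cong: sum.cong)

lemma psd_form_subset:
  assumes "psd_form I Q" "finite I" "J \<subseteq> I"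
  shows "psd_form J Q"
proof -
  have "0 \<le> (\<Sum>i\<in>J. \<Sum>j\<in>J. v i * v j * Q i j)" for v :: "'a \<Rightarrow> real"
  proof -
    let ?w = "\<lambda>i. if i \<in> J then v i else 0"
    have "(\<Sum>i\<in>I. \<Sum>j\<in>I. ?w i * ?w j * Q i j) = (\<Sum>i\<in>J. \<Sum>j\<in>I. ?w i * ?w j * Q i j)"
      using assms(2,3) by (intro sum.mono_neutral_right) auto
    also have "\<dots> = (\<Sum>i\<in>J. \<Sum>j\<in>J. ?w i * ?w j * Q i j)"
      using assms(2,3) by (intro sum.cong sum.mono_neutral_right) auto
    also have "\<dots> = (\<Sum>i\<in>J. \<Sum>j\<in>J. v i * v j * Q i j)"
      by simp
    finally show ?thesis
      using psd_form_nonneg[OF assms(1), of ?w] by simp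
  qed
  moreover have "Q i j = Q j i" if "i \<in> J" "j \<in> J" for i j
    using psd_form_sym[OF assms(1)] that assms(3) by blast
  ultimately show ?thesis
    by (intro psd_formI)
qed

lemma psd_form_reindex:
  assumes h: "bij_betw h I J" and psd: "psd_form I (\<lambda>k l. Q (h k) (h l))"
  shows "psd_form J Q"
proof -
  have J: "J = h ` I"
    using h by (simp add: bij_betw_def)
  have "(\<Sum>i\<in>J. \<Sum>j\<in>J. v i * v j * Q i j)
      = (\<Sum>k\<in>I. \<Sum>l\<in>I. v (h k) * v (h l) * Q (h k) (h l))" for v
    by (simp add: sum.reindex_bij_betw[OF h, symmetric])
  moreover have "Q i j = Q j i" if "i \<in> J" "j \<in> J" for i j
    using psd_form_sym[OF psd] that unfolding J by blast
  ultimately show ?thesis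
    using psd_form_nonneg[OF psd] by (intro psd_formI) auto
qed

lemma psd_form_scale:
  assumes "psd_form I Q"
  shows "psd_form I (\<lambda>i j. c i * c j * Q i j)"
proof -
  have "(\<Sum>i\<in>I. \<Sum>j\<in>I. v i * v j * (c i * c j * Q i j))
      = (\<Sum>i\<in>I. \<Sum>j\<in>I. (v i * c i) * (v j * c j) * Q i j)" for v
    by (simp add: algebra_simps)
  then show ?thesis
    using psd_form_nonneg[OF assms] psd_form_sym[OF assms] by (intro psd_formI) simp_all
qed

text \<open>The expansion of the form along the coordinate vector \<open>e\<close> of
  \<open>p\<close>, a quadratic polynomial in \<open>t\<close>. Diagonal entries, vanishing pivots
  and Schur complements are all treated by a choice of \<open>t\<close>.\<close>

lemma quadratic_form_shift:
  fixes Q :: "'a \<Rightarrow> 'a \<Rightarrow> real"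
  assumes "finite I" "p \<in> I" "\<And>i j. i \<in> I \<Longrightarrow> j \<in> I \<Longrightarrow> Q i j = Q j i"
  defines "e \<equiv> \<lambda>i. if i = p then 1 else (0 :: real)"
  shows "(\<Sum>i\<in>I. \<Sum>j\<in>I. (v i + t * e i) * (v j + t * e j) * Q i j)
    = (\<Sum>i\<in>I. \<Sum>j\<in>I. v i * v j * Q i j) + 2 * t * (\<Sum>i\<in>I. Q p i * v i) + t\<^sup>2 * Q p p"
proof -
  have e: "(\<Sum>i\<in>I. e i * f i) = f p" for f :: "'a \<Rightarrow> real"
  proof -
    have "(\<Sum>i\<in>I. e i * f i) = (\<Sum>i\<in>I. if i = p then f i else 0)"
      by (intro sum.cong) (auto simp: e_def)
    then show ?thesis
      using assms(1,2) by simp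
  qed
  have "(\<Sum>i\<in>I. \<Sum>j\<in>I. (v i + t * e i) * (v j + t * e j) * Q i j)
      = (\<Sum>i\<in>I. \<Sum>j\<in>I. v i * v j * Q i j) + (\<Sum>i\<in>I. t * v i * (\<Sum>j\<in>I. e j * Q i j))
        + (\<Sum>i\<in>I. e i * (t * (\<Sum>j\<in>I. v j * Q i j))) + (\<Sum>i\<in>I. e i * (t\<^sup>2 * (\<Sum>j\<in>I. e j * Q i j)))"
    by (simp add: sum.distrib sum_distrib_left algebra_simps power2_eq_square)
  also have "\<dots> = (\<Sum>i\<in>I. \<Sum>j\<in>I. v i * v j * Q i j) + t * (\<Sum>i\<in>I. v i * Q i p)
        + t * (\<Sum>j\<in>I. v j * Q p j) + t\<^sup>2 * Q p p"
    by (simp only: e) (simp add: sum_distrib_left mult.assoc)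
  also have "(\<Sum>i\<in>I. v i * Q i p) = (\<Sum>i\<in>I. Q p i * v i)"
    using assms(2,3) by (intro sum.cong) auto
  also have "(\<Sum>i\<in>I. v i * Q p i) = (\<Sum>i\<in>I. Q p i * v i)"
    by (intro sum.cong) auto
  finally show ?thesis by (simp add: algebra_simps)
qed

lemma psd_form_diag_nonneg:
  assumes "psd_form I Q" "finite I" "p \<in> I"
  shows "0 \<le> Q p p"
proof -
  have "0 \<le> (\<Sum>i\<in>I. \<Sum>j\<in>I. (0 + 1 * (if i = p then 1 else 0)) * (0 + 1 * (if j = p then 1 else 0)) * Q i j)"
    by (rule psd_form_nonneg[OF assms(1)])
  also have "\<dots> = Q p p"
    by (subst quadratic_form_shift[where v = "\<lambda>_. 0", OF assms(2,3) psd_form_sym[OF assms(1)]]) simp_all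
  finally show ?thesis .
qed

text \<open>With \<open>Q p p = 0\<close> the expansion is affine in \<open>t\<close>, hence bounded
  below only if its slope vanishes.\<close>

lemma psd_form_diag_zero:
  assumes "psd_form I Q" "finite I" "p \<in> I" "j \<in> I" "Q p p = 0"
  shows "Q p j = 0"
proof (rule ccontr)
  assume nz: "Q p j \<noteq> 0"
  let ?v = "\<lambda>i. if i = j then 1 else 0 :: real"
  \<comment> \<open>Chosen to give the form the value -1.\<close>
  let ?t = "- (Q j j + 1) / (2 * Q p j)"
  have "(\<Sum>i\<in>I. Q p i * ?v i) = Q p j"
    using assms by (simp add: if_distrib[of "\<lambda>x. _ * x"] cong: if_cong)
  moreover have "(\<Sum>i\<in>I. \<Sum>k\<in>I. ?v i * ?v k * Q i k) = Q j j"
  proof -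
    have "(\<Sum>i\<in>I. \<Sum>k\<in>I. ?v i * ?v k * Q i k)
      = (\<Sum>i\<in>I. if i = j then (\<Sum>k\<in>I. if k = j then Q i k else 0) else 0)"
      by (intro sum.cong) (auto intro!: sum.cong)
    then show ?thesis using assms by simp
  qed
  ultimately have "0 \<le> Q j j + 2 * ?t * Q p j"
    using quadratic_form_shift[where Q = Q and v = ?v and t = ?t, OF assms(2,3) psd_form_sym[OF assms(1)]]
      psd_form_nonneg[OF assms(1), of "\<lambda>i. ?v i + ?t * (if i = p then 1 else 0)"] assms(5)
    by simp
  also have "\<dots> = -1"
    using nz by (simp add: field_simps)
  finally show False by simp
qed

text \<open>For a vanishing pivot the division by zero leaves the form unchanged.\<close>

definition schur_compl :: "'a \<Rightarrow> ('a \<Rightarrow> 'a \<Rightarrow> real) \<Rightarrow> 'a \<Rightarrow> 'a \<Rightarrow> real" where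
  "schur_compl p Q i j = Q i j - Q p i * Q p j / Q p p"

text \<open>Completing the square: the complement at \<open>v\<close> equals \<open>Q\<close> at
  \<open>v\<close> moved by \<open>?t\<close> along the coordinate \<open>p\<close>, which for a
  positive pivot is the minimum over all such moves.\<close>

lemma psd_form_schur_compl:
  assumes "psd_form I Q" "finite I" "p \<in> I"
  shows "psd_form I (schur_compl p Q)"
proof -
  have "0 \<le> (\<Sum>i\<in>I. \<Sum>j\<in>I. v i * v j * schur_compl p Q i j)" for v :: "'a \<Rightarrow> real"
  proof -
    let ?s = "\<Sum>i\<in>I. Q p i * v i"
    let ?t = "- ?s / Q p p"
    have "(\<Sum>i\<in>I. \<Sum>j\<in>I. v i * v j * schur_compl p Q i j)
        = (\<Sum>i\<in>I. \<Sum>j\<in>I. v i * v j * Q i j) - (\<Sum>i\<in>I. \<Sum>j\<in>I. Q p i * v i * (Q p j * v j) / Q p p)"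
      by (simp add: schur_compl_def algebra_simps sum_subtractf)
    also have "(\<Sum>i\<in>I. \<Sum>j\<in>I. Q p i * v i * (Q p j * v j) / Q p p) = ?s * ?s / Q p p"
      by (simp only: sum_product sum_divide_distrib)
    also have "(\<Sum>i\<in>I. \<Sum>j\<in>I. v i * v j * Q i j) - ?s * ?s / Q p p
       = (\<Sum>i\<in>I. \<Sum>j\<in>I. v i * v j * Q i j) + 2 * ?t * ?s + ?t\<^sup>2 * Q p p"
      by (cases "Q p p = 0") (simp_all add: power2_eq_square)
    also have "\<dots> \<ge> 0"
      using quadratic_form_shift[where Q = Q and v = v and t = ?t, OF assms(2,3) psd_form_sym[OF assms(1)]]
        psd_form_nonneg[OF assms(1), of "\<lambda>i. v i + ?t * (if i = p then 1 else 0)"]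
      by simp
    finally show ?thesis .
  qed
  moreover have "schur_compl p Q i j = schur_compl p Q j i" if "i \<in> I" "j \<in> I" for i j
    using psd_form_sym[OF assms(1) that] by (simp add: schur_compl_def mult.commute)
  ultimately show ?thesis
    by (intro psd_formI)
qed

text \<open>Symmetric elimination as in a Cholesky factorization: the pivot contributes one rank-one
  term, the Schur complement on the remaining indices the others.\<close>

lemma psd_form_gram:
  assumes "finite I" "psd_form I Q"
  shows "\<exists>y. \<forall>i\<in>I. \<forall>j\<in>I. Q i j = (\<Sum>k\<in>I. y k i * y k j)"
  using assms
proof (induction I arbitrary: Q rule: finite_induct)
  case empty
  then show ?case by simp
next
  case (insert p F)
  let ?I = "insert p F"
  have fin: "finite ?I" using insert by simp
  have "psd_form F (schur_compl p Q)"
    using psd_form_subset[OF psd_form_schur_compl[OF insert.prems fin]] fin by blast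
  then obtain y where y: "\<And>i j. i \<in> F \<Longrightarrow> j \<in> F \<Longrightarrow> schur_compl p Q i j = (\<Sum>k\<in>F. y k i * y k j)"
    using insert.IH by metis
  \<comment> \<open>Vector \<open>p\<close> is the rank-one term of the pivot, and is zero for a
    vanishing pivot because division by zero gives 0. The others come from the complement and are
    set to 0 at \<open>p\<close>.\<close>
  let ?y = "\<lambda>k i. if k = p then Q p i / sqrt (Q p p) else if i = p then 0 else y k i"
  have pp: "0 \<le> Q p p"
    using psd_form_diag_nonneg[OF insert.prems fin] by simp
  have z: "Q p i = 0" if "Q p p = 0" "i \<in> ?I" for i
    using psd_form_diag_zero[OF insert.prems fin _ that(2) that(1)] by simp
  have sym: "Q i p = Q p i" if "i \<in> F" for i
    using psd_form_sym[OF insert.prems] that by auto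
  have "Q i j = (\<Sum>k\<in>?I. ?y k i * ?y k j)" if "i \<in> ?I" "j \<in> ?I" for i j
  proof -
    have "(\<Sum>k\<in>?I. ?y k i * ?y k j)
        = Q p i * Q p j / Q p p + (\<Sum>k\<in>F. (if i = p then 0 else y k i) * (if j = p then 0 else y k j))"
      using insert.hyps pp by (auto intro!: sum.cong)
    also have "\<dots> = Q i j"
    proof (cases "i = p \<or> j = p")
      case True
      then show ?thesis
        using z that sym by (cases "Q p p = 0"; cases "i = p") auto
    next
      case False
      then have "(\<Sum>k\<in>F. (if i = p then 0 else y k i) * (if j = p then 0 else y k j)) = schur_compl p Q i j"
        using y that by auto
      then show ?thesis
        by (simp add: schur_compl_def)
    qed
    finally show ?thesis by simp
  qed
  then show ?case by (intro exI[of _ ?y] ballI)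
qed

text \<open>Eliminating an index by a Schur complement keeps the off-diagonal entries nonpositive,
  and back substitution extends a positive vector for the complement to one for \<open>C\<close>.\<close>

lemma psd_form_positive_vector:
  assumes "finite I" "psd_form I C" "\<And>i j. i \<in> I \<Longrightarrow> j \<in> I \<Longrightarrow> i \<noteq> j \<Longrightarrow> C i j \<le> 0"
  shows "\<exists>d. (\<forall>i\<in>I. 0 < d i) \<and> (\<forall>i\<in>I. 0 \<le> (\<Sum>j\<in>I. C i j * d j))"
  using assms
proof (induction I arbitrary: C rule: finite_induct)
  case empty
  then show ?case by simp
next
  case (insert p F)
  let ?I = "insert p F"
  have fin: "finite ?I" using insert by simp
  have pp: "0 \<le> C p p"
    using psd_form_diag_nonneg[OF insert.prems(1) fin] by simp
  have z: "C p i = 0" if "C p p = 0" "i \<in> F" for i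
    using psd_form_diag_zero[OF insert.prems(1) fin _ _ that(1)] that by simp
  have sym: "C i p = C p i" if "i \<in> F" for i
    using psd_form_sym[OF insert.prems(1)] that by auto
  have neg: "C p i \<le> 0" if "i \<in> F" for i
    using insert.prems(2)[of p i] insert.hyps that by auto
  have "psd_form F (schur_compl p C)"
    using psd_form_subset[OF psd_form_schur_compl[OF insert.prems(1) fin]] fin by blast
  moreover have "schur_compl p C i j \<le> 0" if "i \<in> F" "j \<in> F" "i \<noteq> j" for i j
  proof -
    have "0 \<le> C p i * C p j / C p p"
      using neg that pp by (simp add: mult_nonpos_nonpos)
    then show ?thesis
      using insert.prems(2)[of i j] that by (simp add: schur_compl_def)
  qed
  ultimately obtain d where d: "\<And>i. i \<in> F \<Longrightarrow> 0 < d i"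
      "\<And>i. i \<in> F \<Longrightarrow> 0 \<le> (\<Sum>j\<in>F. schur_compl p C i j * d j)"
    using insert.IH[of "schur_compl p C"] by metis
  let ?s = "\<Sum>j\<in>F. C p j * d j"
  \<comment> \<open>Back substitution: this makes entry \<open>p\<close> of the image zero. If
    \<open>?s = 0\<close>, which a vanishing pivot forces, any positive number would serve.\<close>
  define e where "e = (if ?s = 0 then 1 else - ?s / C p p)"
  let ?d = "d(p := e)"
  have s: "?s \<le> 0"
    using d neg by (intro sum_nonpos) (simp add: mult_nonpos_nonneg less_imp_le)
  have s0: "?s = 0" if "C p p = 0"
    using z that by simp
  \<comment> \<open>All summands of \<open>?s\<close> are nonpositive and \<open>d\<close> is
    positive, so a zero sum decouples \<open>p\<close> from \<open>F\<close>.\<close>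
  have zero: "C p i = 0" if "?s = 0" "i \<in> F" for i
  proof -
    have "\<forall>j\<in>F. - (C p j * d j) = 0"
      using that(1) insert.hyps d neg
      by (subst sum_nonneg_eq_0_iff[symmetric])
        (auto simp: sum_negf intro: mult_nonpos_nonneg less_imp_le)
    then show ?thesis
      using that(2) d(1)[of i] by auto
  qed
  have e: "0 < e"
    using s s0 pp by (cases "C p p = 0") (auto simp: e_def intro!: divide_neg_pos)
  have sumI: "(\<Sum>j\<in>?I. C i j * ?d j) = C i p * e + (\<Sum>j\<in>F. C i j * d j)" for i
    using insert.hyps by (auto intro!: sum.cong)
  have "0 \<le> (\<Sum>j\<in>?I. C i j * ?d j)" if "i \<in> ?I" for i
  proof (cases "i = p")
    case True
    then show ?thesis
      unfolding sumI using pp s0 by (cases "?s = 0") (auto simp: e_def)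
  next
    case False
    then have i: "i \<in> F" using that by simp
    have "(\<Sum>j\<in>F. schur_compl p C i j * d j) = (\<Sum>j\<in>F. C i j * d j - C p i / C p p * (C p j * d j))"
      by (intro sum.cong) (auto simp: schur_compl_def algebra_simps)
    also have "\<dots> = (\<Sum>j\<in>F. C i j * d j) - C p i / C p p * ?s"
      by (simp only: sum_subtractf sum_distrib_left)
    also have "\<dots> = C i p * e + (\<Sum>j\<in>F. C i j * d j)"
      using zero[OF _ i] sym[OF i] by (cases "?s = 0") (auto simp: e_def)
    finally show ?thesis
      unfolding sumI using d(2)[OF i] by simp
  qed
  moreover have "\<forall>i\<in>?I. 0 < ?d i"
    using e d by auto
  ultimately show ?case by blast
qed

section \<open>Completely positive forms\<close>

text \<open>\<open>k\<close> numbers the coordinates and \<open>i\<close> the vectors. Allowing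
  \<open>m = 0\<close> gives the zero form an empty decomposition.\<close>

definition cp_form :: "'a set \<Rightarrow> ('a \<Rightarrow> 'a \<Rightarrow> real) \<Rightarrow> bool" where
  "cp_form I Q \<longleftrightarrow> (\<exists>m :: nat. \<exists>y. (\<forall>k<m. \<forall>i\<in>I. 0 \<le> y k i) \<and>
     (\<forall>i\<in>I. \<forall>j\<in>I. Q i j = (\<Sum>k<m. y k i * y k j)))"

lemma cp_formE:
  assumes "cp_form I Q"
  obtains m :: nat and y where "\<And>k i. k < m \<Longrightarrow> i \<in> I \<Longrightarrow> 0 \<le> y k i"
    "\<And>i j. i \<in> I \<Longrightarrow> j \<in> I \<Longrightarrow> Q i j = (\<Sum>k<m. y k i * y k j)"
  using assms unfolding cp_form_def by blast

lemma cp_form_cong: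
  assumes "\<And>i j. i \<in> I \<Longrightarrow> j \<in> I \<Longrightarrow> Q i j = R i j"
  shows "cp_form I Q \<longleftrightarrow> cp_form I R"
  using assms by (simp add: cp_form_def)

lemma cp_form_zero: "cp_form I (\<lambda>i j. 0)"
  unfolding cp_form_def by (rule exI[of _ 0]) simp

lemma cp_form_add_rank_one:
  assumes "cp_form I Q" "0 \<le> c" "\<And>i. i \<in> I \<Longrightarrow> 0 \<le> x i"
  shows "cp_form I (\<lambda>i j. c * x i * x j + Q i j)"
proof -
  obtain m :: nat and y where y: "\<And>k i. k < m \<Longrightarrow> i \<in> I \<Longrightarrow> 0 \<le> y k i"
      "\<And>i j. i \<in> I \<Longrightarrow> j \<in> I \<Longrightarrow> Q i j = (\<Sum>k<m. y k i * y k j)"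
    using cp_formE[OF assms(1)] by metis
  obtain s where s: "0 \<le> s" "c = s * s"
    using real_sqrt_ge_zero[OF assms(2)] real_sqrt_mult_self[of c] abs_of_nonneg[OF assms(2)] by metis
  let ?y = "\<lambda>k i. if k = m then s * x i else y k i"
  have "\<forall>k<Suc m. \<forall>i\<in>I. 0 \<le> ?y k i"
    using y assms s by (auto simp: less_Suc_eq)
  moreover have "\<forall>i\<in>I. \<forall>j\<in>I. c * x i * x j + Q i j = (\<Sum>k<Suc m. ?y k i * ?y k j)"
    using y(2) by (simp add: s mult_ac)
  ultimately show ?thesis
    unfolding cp_form_def by (intro exI[of _ "Suc m"] exI[of _ ?y] conjI)
qed

lemma cp_form_sum_rank_one:
  assumes "finite K" "cp_form I Q" "\<And>k. k \<in> K \<Longrightarrow> 0 \<le> c k" "\<And>k i. k \<in> K \<Longrightarrow> i \<in> I \<Longrightarrow> 0 \<le> x k i"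
  shows "cp_form I (\<lambda>i j. (\<Sum>k\<in>K. c k * x k i * x k j) + Q i j)"
  using assms
proof (induction K rule: finite_induct)
  case empty
  then show ?case by simp
next
  case (insert k K)
  then have "cp_form I (\<lambda>i j. c k * x k i * x k j + ((\<Sum>k\<in>K. c k * x k i * x k j) + Q i j))"
    by (intro cp_form_add_rank_one) auto
  then show ?case
    using insert.hyps by (simp add: add.assoc)
qed

lemma cp_form_scale:
  assumes "cp_form I Q" "\<And>i. i \<in> I \<Longrightarrow> 0 \<le> c i"
  shows "cp_form I (\<lambda>i j. c i * c j * Q i j)"
proof -
  obtain m :: nat and y where y: "\<And>k i. k < m \<Longrightarrow> i \<in> I \<Longrightarrow> 0 \<le> y k i"
      "\<And>i j. i \<in> I \<Longrightarrow> j \<in> I \<Longrightarrow> Q i j = (\<Sum>k<m. y k i * y k j)"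
    using cp_formE[OF assms(1)] by metis
  have "\<forall>k<m. \<forall>i\<in>I. 0 \<le> c i * y k i"
    using y assms by auto
  moreover have "\<forall>i\<in>I. \<forall>j\<in>I. c i * c j * Q i j = (\<Sum>k<m. (c i * y k i) * (c j * y k j))"
    using y(2) by (auto simp: sum_distrib_left mult_ac)
  ultimately show ?thesis
    unfolding cp_form_def by (intro exI[of _ m] exI[of _ "\<lambda>k i. c i * y k i"]) auto
qed

text \<open>The summand for \<open>(k, l)\<close> is a multiple of the square of \<open>e\<^sub>k + e\<^sub>l\<close>; what then remains of
  the diagonal is nonnegative by dominance.\<close>

lemma cp_form_diagonally_dominant:
  assumes fin: "finite I"
    and sym: "\<And>i j. i \<in> I \<Longrightarrow> j \<in> I \<Longrightarrow> Q i j = Q j i"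
    and nonneg: "\<And>i j. i \<in> I \<Longrightarrow> j \<in> I \<Longrightarrow> 0 \<le> Q i j"
    and dom: "\<And>i. i \<in> I \<Longrightarrow> (\<Sum>j\<in>I - {i}. Q i j) \<le> Q i i"
  shows "cp_form I Q"
proof -
  define \<delta> :: "'a \<Rightarrow> 'a \<Rightarrow> real" where "\<delta> = (\<lambda>i j. if i = j then 1 else 0)"
  \<comment> \<open>Halved because the sum over \<open>I \<times> I\<close> meets every pair in both
    orders; \<open>r\<close> is the surplus of the diagonal.\<close>
  define z where "z = (\<lambda>i j. if i = j then 0 else Q i j / 2)"
  define r where "r = (\<lambda>i. Q i i - (\<Sum>j\<in>I - {i}. Q i j))"
  have \<delta>: "(\<Sum>k\<in>I. \<delta> i k * f k) = f i" if "i \<in> I" for i and f :: "'a \<Rightarrow> real"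
  proof -
    have "(\<Sum>k\<in>I. \<delta> i k * f k) = (\<Sum>k\<in>I. if i = k then f k else 0)"
      by (intro sum.cong) (auto simp: \<delta>_def)
    then show ?thesis
      using fin that by simp
  qed
  have zsym: "z i j = z j i" if "i \<in> I" "j \<in> I" for i j
    using sym that by (auto simp: z_def)
  have zsum: "2 * (\<Sum>l\<in>I. z i l) + r i = Q i i" if "i \<in> I" for i
  proof -
    have "(\<Sum>l\<in>I. z i l) = (\<Sum>l\<in>I - {i}. z i l)"
      using fin that by (intro sum.mono_neutral_right) (auto simp: z_def)
    also have "\<dots> = (\<Sum>l\<in>I - {i}. Q i l) / 2"
      unfolding sum_divide_distrib by (intro sum.cong) (auto simp: z_def)
    finally show ?thesis by (simp add: r_def)
  qed
  let ?x = "\<lambda>(k, l) i. \<delta> i k + \<delta> i l"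
  let ?R = "\<lambda>i j. (\<Sum>p\<in>I \<times> I. (case p of (k, l) \<Rightarrow> z k l) * ?x p i * ?x p j)
      + ((\<Sum>k\<in>I. r k * \<delta> i k * \<delta> j k) + 0)"
  have "cp_form I ?R"
    using fin nonneg dom
    by (intro cp_form_sum_rank_one cp_form_zero) (auto simp: z_def \<delta>_def r_def)
  moreover have "?R i j = Q i j" if ij: "i \<in> I" "j \<in> I" for i j
  proof -
    have "(\<Sum>p\<in>I \<times> I. (case p of (k, l) \<Rightarrow> z k l) * ?x p i * ?x p j)
       = (\<Sum>k\<in>I. \<Sum>l\<in>I. z k l * (\<delta> i k + \<delta> i l) * (\<delta> j k + \<delta> j l))"
      by (simp add: sum.cartesian_product split_def)
    also have "\<dots> = (\<Sum>k\<in>I. \<delta> i k * (\<delta> j k * (\<Sum>l\<in>I. z k l))) + (\<Sum>k\<in>I. \<delta> i k * (\<Sum>l\<in>I. \<delta> j l * z k l))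
       + (\<Sum>k\<in>I. \<delta> j k * (\<Sum>l\<in>I. \<delta> i l * z k l)) + (\<Sum>k\<in>I. \<Sum>l\<in>I. \<delta> i l * (\<delta> j l * z k l))"
      by (simp add: sum.distrib sum_distrib_left algebra_simps)
    also have "\<dots> = \<delta> j i * (\<Sum>l\<in>I. z i l) + z i j + z j i + \<delta> j i * (\<Sum>k\<in>I. z k i)"
      by (simp only: \<delta> ij) (simp add: sum_distrib_left)
    also have "(\<Sum>k\<in>I. z k i) = (\<Sum>k\<in>I. z i k)"
      using zsym ij by (intro sum.cong) auto
    finally have 1: "(\<Sum>p\<in>I \<times> I. (case p of (k, l) \<Rightarrow> z k l) * ?x p i * ?x p j)
       = 2 * \<delta> j i * (\<Sum>l\<in>I. z i l) + 2 * z i j"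
      using zsym[OF ij] by simp
    have "(\<Sum>k\<in>I. r k * \<delta> i k * \<delta> j k) = (\<Sum>k\<in>I. \<delta> i k * (r k * \<delta> j k))"
      by (simp add: mult_ac)
    then have 2: "(\<Sum>k\<in>I. r k * \<delta> i k * \<delta> j k) = r i * \<delta> j i"
      using \<delta>[OF ij(1), of "\<lambda>k. r k * \<delta> j k"] by simp
    show ?thesis
      unfolding 1 2 using zsum[OF ij(1)] by (auto simp: \<delta>_def z_def)
  qed
  ultimately show ?thesis
    using cp_form_cong[of I ?R Q] by blast
qed

text \<open>No absolute values are taken: for entrywise nonnegative \<open>Q\<close> this is the
  usual comparison matrix.\<close>

definition comparison :: "('a \<Rightarrow> 'a \<Rightarrow> real) \<Rightarrow> 'a \<Rightarrow> 'a \<Rightarrow> real" where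
  "comparison Q i j = (if i = j then Q i j else - Q i j)"

text \<open>The positive vector \<open>d\<close> turns nonnegativity of its image into diagonal
  dominance of \<open>d i * d j * Q i j\<close>, and complete positivity survives undoing this
  scaling.\<close>

lemma cp_form_of_psd_comparison:
  assumes fin: "finite I" and nonneg: "\<And>i j. i \<in> I \<Longrightarrow> j \<in> I \<Longrightarrow> 0 \<le> Q i j"
    and psd: "psd_form I (comparison Q)"
  shows "cp_form I Q"
proof -
  have "comparison Q i j \<le> 0" if "i \<in> I" "j \<in> I" "i \<noteq> j" for i j
    using nonneg that by (simp add: comparison_def)
  then obtain d where d: "\<And>i. i \<in> I \<Longrightarrow> 0 < d i"
      and cd: "\<And>i. i \<in> I \<Longrightarrow> 0 \<le> (\<Sum>j\<in>I. comparison Q i j * d j)"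
    using psd_form_positive_vector[OF fin psd] by metis
  have sym: "Q i j = Q j i" if "i \<in> I" "j \<in> I" for i j
    using psd_form_sym[OF psd that] by (auto simp: comparison_def split: if_splits)
  have "cp_form I (\<lambda>i j. d i * d j * Q i j)"
  proof (rule cp_form_diagonally_dominant[OF fin])
    fix i assume i: "i \<in> I"
    have "(\<Sum>j\<in>I. comparison Q i j * d j) = Q i i * d i + (\<Sum>j\<in>I - {i}. comparison Q i j * d j)"
      using fin i by (subst sum.remove) (auto simp: comparison_def)
    also have "(\<Sum>j\<in>I - {i}. comparison Q i j * d j) = - (\<Sum>j\<in>I - {i}. Q i j * d j)"
      unfolding sum_negf[symmetric] by (intro sum.cong) (auto simp: comparison_def)
    finally have "(\<Sum>j\<in>I - {i}. Q i j * d j) \<le> Q i i * d i"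
      using cd[OF i] by simp
    then have "d i * (\<Sum>j\<in>I - {i}. Q i j * d j) \<le> d i * (Q i i * d i)"
      using d[OF i] by (intro mult_left_mono) auto
    then show "(\<Sum>j\<in>I - {i}. d i * d j * Q i j) \<le> d i * d i * Q i i"
      by (simp add: sum_distrib_left mult_ac)
  qed (use d nonneg sym in \<open>auto simp: less_imp_le\<close>)
  then have "cp_form I (\<lambda>i j. inverse (d i) * inverse (d j) * (d i * d j * Q i j))"
    by (rule cp_form_scale) (simp add: d less_imp_le)
  moreover have "inverse (d i) * inverse (d j) * (d i * d j * Q i j) = Q i j" if "i \<in> I" "j \<in> I" for i j
    using d[OF that(1)] d[OF that(2)] by (simp add: field_simps)
  ultimately show ?thesis
    using cp_form_cong[of I "\<lambda>i j. inverse (d i) * inverse (d j) * (d i * d j * Q i j)" Q] by blast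
qed

text \<open>The pivot condition makes the entry at \<open>q\<close>, \<open>r\<close> of the Schur
  complement nonnegative. That complement lives on two indices only, where flipping one sign yields
  the comparison matrix; the rank-one term of the pivot is then added back.\<close>

lemma cp_form_pivot3:
  assumes I: "I = {p, q, r}" "p \<noteq> q" "p \<noteq> r" "q \<noteq> r"
    and psd: "psd_form I Q" and nonneg: "\<And>i j. i \<in> I \<Longrightarrow> j \<in> I \<Longrightarrow> 0 \<le> Q i j"
    and pivot: "Q p q * Q p r \<le> Q p p * Q q r"
  shows "cp_form I Q"
proof -
  have fin: "finite I" and mem: "p \<in> I" "q \<in> I" "r \<in> I" using I by auto
  let ?S = "schur_compl p Q"
  have S: "psd_form I ?S"
    using psd_form_schur_compl[OF psd fin mem(1)] .
  have z: "Q p i = 0" if "Q p p = 0" "i \<in> I" for i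
    using psd_form_diag_zero[OF psd fin mem(1) that(2,1)] .
  have pp: "0 \<le> Q p p" using nonneg mem by simp
  have Sp: "?S p i = 0" if "i \<in> I" for i
    using z that by (cases "Q p p = 0") (auto simp: schur_compl_def)
  have Sp': "?S i p = 0" if "i \<in> I" for i
    using Sp[OF that] psd_form_sym[OF S that mem(1)] by simp
  have Sqr: "0 \<le> ?S q r"
    using pivot pp nonneg[OF mem(2,3)] by (cases "Q p p = 0") (auto simp: schur_compl_def field_simps)
  have Srq: "?S r q = ?S q r"
    using psd_form_sym[OF S] mem by auto
  have diag: "0 \<le> ?S i i" if "i \<in> I" for i
    using psd_form_diag_nonneg[OF S fin that] .
  let ?c = "\<lambda>i. if i = q then -1 else 1 :: real"
  have "psd_form I (\<lambda>i j. ?c i * ?c j * ?S i j)"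
    using psd_form_scale[OF S] .
  moreover have "?c i * ?c j * ?S i j = comparison ?S i j" if "i \<in> I" "j \<in> I" for i j
    using that I Sp Sp' by (auto simp: comparison_def)
  ultimately have "psd_form I (comparison ?S)"
    using psd_form_cong[of I "\<lambda>i j. ?c i * ?c j * ?S i j" "comparison ?S"] by blast
  moreover have "0 \<le> ?S i j" if "i \<in> I" "j \<in> I" for i j
    using that I Sp Sp' Sqr Srq diag by auto
  ultimately have "cp_form I ?S"
    using cp_form_of_psd_comparison[OF fin] by blast
  \<comment> \<open>\<open>inverse 0 = 0\<close> agrees with the division by zero in
    \<open>schur_compl\<close>, so a vanishing pivot is covered too.\<close>
  then have "cp_form I (\<lambda>i j. inverse (Q p p) * Q p i * Q p j + ?S i j)"
    using nonneg mem by (intro cp_form_add_rank_one) auto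
  then show ?thesis
    by (simp add: schur_compl_def field_simps)
qed

text \<open>If all three pivots failed, multiplying two of the failing inequalities would make a
  principal \<open>2 \<times> 2\<close> minor negative.\<close>

lemma cp_form_dim3:
  assumes psd: "psd_form {0,1,2} Q" (is "psd_form ?I Q")
    and nonneg: "\<And>i j. i \<in> {0,1,2} \<Longrightarrow> j \<in> {0,1,2} \<Longrightarrow> 0 \<le> Q i j"
  shows "cp_form {0,1,2::nat} Q"
proof (cases "Q 0 1 * Q 0 2 \<le> Q 0 0 * Q 1 2 \<or> Q 1 0 * Q 1 2 \<le> Q 1 1 * Q 0 2")
  case True
  then show ?thesis
  proof
    assume "Q 0 1 * Q 0 2 \<le> Q 0 0 * Q 1 2"
    then show ?thesis
      by (intro cp_form_pivot3[where p = 0 and q = 1 and r = 2, OF _ _ _ _ psd nonneg]) auto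
  next
    assume "Q 1 0 * Q 1 2 \<le> Q 1 1 * Q 0 2"
    then show ?thesis
      by (intro cp_form_pivot3[where p = 1 and q = 0 and r = 2, OF _ _ _ _ psd nonneg]) auto
  qed
next
  case False
  have sym: "Q 1 0 = Q 0 1"
    using psd_form_sym[OF psd] by simp
  have nn: "0 \<le> Q 0 0" "0 \<le> Q 1 1" "0 \<le> Q 0 1" "0 \<le> Q 0 2" "0 \<le> Q 1 2"
    using nonneg by simp_all
  \<comment> \<open>The failures at the pivots 0 and 1 are multiplied; the common factor
    \<open>Q 0 2 * Q 1 2\<close> then cancels.\<close>
  have "(Q 0 0 * Q 1 2) * (Q 1 1 * Q 0 2) < (Q 0 1 * Q 0 2) * (Q 0 1 * Q 1 2)"
    using False nn sym
    by (intro mult_strict_mono'[of "Q 0 0 * Q 1 2" "Q 0 1 * Q 0 2"]) (auto simp: not_le)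
  then have "Q 0 2 * Q 1 2 * (Q 0 0 * Q 1 1) < Q 0 2 * Q 1 2 * (Q 0 1 * Q 0 1)"
    by (simp add: mult_ac)
  then have minor: "Q 0 0 * Q 1 1 < Q 0 1 * Q 0 1"
    using nn by (metis mult_left_less_imp_less mult_nonneg_nonneg)
  \<comment> \<open>This diagonal entry is the minor divided by \<open>Q 0 0\<close>.\<close>
  have "0 \<le> schur_compl 0 Q 1 1"
    using psd_form_diag_nonneg[OF psd_form_schur_compl[OF psd]] by simp
  moreover have "Q 0 0 \<noteq> 0"
    using psd_form_diag_zero[OF psd, of 0 1] minor by auto
  ultimately have False
    using minor nn by (simp add: schur_compl_def field_simps)
  then show ?thesis ..
qed

section \<open>Traces of products of positive semidefinite matrices\<close>

lemma sum_swap4: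
  "(\<Sum>i\<in>A. \<Sum>j\<in>B. \<Sum>k\<in>C. \<Sum>l\<in>D. f i j k l) = (\<Sum>k\<in>C. \<Sum>l\<in>D. \<Sum>i\<in>A. \<Sum>j\<in>B. f i j k l)"
proof -
  have "(\<Sum>i\<in>A. \<Sum>j\<in>B. \<Sum>k\<in>C. \<Sum>l\<in>D. f i j k l) = (\<Sum>i\<in>A. \<Sum>k\<in>C. \<Sum>j\<in>B. \<Sum>l\<in>D. f i j k l)"
    by (rule sum.cong[OF refl], rule sum.swap)
  also have "\<dots> = (\<Sum>k\<in>C. \<Sum>i\<in>A. \<Sum>j\<in>B. \<Sum>l\<in>D. f i j k l)"
    by (rule sum.swap)
  also have "\<dots> = (\<Sum>k\<in>C. \<Sum>i\<in>A. \<Sum>l\<in>D. \<Sum>j\<in>B. f i j k l)"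
    by (rule sum.cong[OF refl], rule sum.cong[OF refl], rule sum.swap)
  also have "\<dots> = (\<Sum>k\<in>C. \<Sum>l\<in>D. \<Sum>i\<in>A. \<Sum>j\<in>B. f i j k l)"
    by (rule sum.cong[OF refl], rule sum.swap)
  finally show ?thesis .
qed

lemma index_mult_mat_sum:
  assumes "X \<in> carrier_mat n d" "Y \<in> carrier_mat d m" "i < n" "j < m"
  shows "(X * Y) $$ (i, j) = (\<Sum>k<d. X $$ (i, k) * Y $$ (k, j))"
  using assms by (simp add: scalar_prod_def atLeast0LessThan)

lemma trace_inner_eq_sum:
  assumes "X \<in> carrier_mat d d" "Y \<in> carrier_mat d d"
  shows "trace_inner X Y = (\<Sum>i<d. \<Sum>j<d. X $$ (i, j) * Y $$ (j, i))"
proof -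
  have "dim_row (X * Y) = d" using assms by simp
  then show ?thesis
    using index_mult_mat_sum[OF assms] by (simp add: trace_inner_def mat_trace_def)
qed

lemma trace_inner_commute:
  assumes "X \<in> carrier_mat d d" "Y \<in> carrier_mat d d"
  shows "trace_inner X Y = trace_inner Y X"
  unfolding trace_inner_eq_sum[OF assms] trace_inner_eq_sum[OF assms(2,1)]
  by (subst sum.swap) (simp add: mult.commute)

lemma one_smult_mat: "(1 :: real) \<cdot>\<^sub>m X = X"
  by (rule eq_matI) auto

lemma trace_inner_smult:
  assumes "X \<in> carrier_mat d d" "Y \<in> carrier_mat d d"
  shows "trace_inner (a \<cdot>\<^sub>m X) (b \<cdot>\<^sub>m Y) = a * b * trace_inner X Y"
  using assms by (simp add: trace_inner_eq_sum[of _ d] sum_distrib_left mult_ac)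

text \<open>The trace is the entrywise inner product, so the form at \<open>v\<close> is the sum of
  the squared entries of the combination of the \<open>Y k\<close> with weights \<open>v k\<close>.
  The transpose admits nonsymmetric \<open>Y k\<close>, such as a symmetric matrix times a
  reflection.\<close>

lemma psd_form_gram_trace_inner:
  assumes "\<And>k. k \<in> I \<Longrightarrow> Y k \<in> carrier_mat d d"
  shows "psd_form I (\<lambda>k l. trace_inner (transpose_mat (Y k)) (Y l))"
proof -
  have eq: "trace_inner (transpose_mat (Y k)) (Y l) = (\<Sum>a<d. \<Sum>b<d. Y k $$ (b, a) * Y l $$ (b, a))"
    if "k \<in> I" "l \<in> I" for k l
    using assms[OF that(1)] assms[OF that(2)] by (simp add: trace_inner_eq_sum[of _ d])
  show ?thesis
  proof (rule psd_formI)
    fix v :: "'a \<Rightarrow> real"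
    have "(\<Sum>k\<in>I. \<Sum>l\<in>I. v k * v l * trace_inner (transpose_mat (Y k)) (Y l))
        = (\<Sum>k\<in>I. \<Sum>l\<in>I. \<Sum>a<d. \<Sum>b<d. (v k * Y k $$ (b, a)) * (v l * Y l $$ (b, a)))"
      by (intro sum.cong refl) (simp add: eq sum_distrib_left mult_ac)
    also have "\<dots> = (\<Sum>a<d. \<Sum>b<d. (\<Sum>k\<in>I. v k * Y k $$ (b, a))\<^sup>2)"
      by (subst sum_swap4) (simp only: power2_eq_square sum_product)
    also have "\<dots> \<ge> 0"
      by (intro sum_nonneg) simp
    finally show "0 \<le> (\<Sum>k\<in>I. \<Sum>l\<in>I. v k * v l * trace_inner (transpose_mat (Y k)) (Y l))" .
  qed (simp add: eq mult.commute)
qed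

lemma psd_matsD:
  assumes "X \<in> psd_mats d"
  shows "X \<in> carrier_mat d d" "transpose_mat X = X"
  using assms by (auto simp: psd_mats_def sym_mats_def)

lemma psd_form_of_psd_mats:
  assumes "X \<in> psd_mats d"
  shows "psd_form {..<d} (\<lambda>i j. X $$ (i, j))"
proof (rule psd_formI)
  note X = psd_matsD[OF assms]
  show "X $$ (i, j) = X $$ (j, i)" if "i \<in> {..<d}" "j \<in> {..<d}" for i j
    using X that by (metis carrier_matD index_transpose_mat(1) lessThan_iff)
  fix v :: "nat \<Rightarrow> real"
  have "vec d v \<bullet> (X *\<^sub>v vec d v) = (\<Sum>i<d. \<Sum>j<d. v i * v j * X $$ (i, j))"
    using X by (simp add: scalar_prod_def atLeast0LessThan sum_distrib_left mult_ac)
  then show "0 \<le> (\<Sum>i<d. \<Sum>j<d. v i * v j * X $$ (i, j))"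
    using assms by (auto simp: psd_mats_def) (metis vec_carrier)
qed

text \<open>Writing \<open>X\<close> and \<open>Y\<close> as sums of \<open>x\<^sub>k x\<^sub>k\<^sup>T\<close> and \<open>y\<^sub>l y\<^sub>l\<^sup>T\<close>, the trace of \<open>X Y\<close> is the sum of the
  squared inner products of \<open>x\<^sub>k\<close> and \<open>y\<^sub>l\<close>, all of which must vanish if the trace does.\<close>

lemma
  assumes X: "X \<in> psd_mats d" and Y: "Y \<in> psd_mats d"
  shows trace_inner_nonneg: "0 \<le> trace_inner X Y"
    and mult_zero_of_trace_inner_zero: "trace_inner X Y = 0 \<Longrightarrow> X * Y = 0\<^sub>m d d"
proof -
  obtain x where x: "\<And>i j. i < d \<Longrightarrow> j < d \<Longrightarrow> X $$ (i, j) = (\<Sum>k<d. x k i * x k j)"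
    using psd_form_gram[OF _ psd_form_of_psd_mats[OF X]] by auto
  obtain y where y: "\<And>i j. i < d \<Longrightarrow> j < d \<Longrightarrow> Y $$ (i, j) = (\<Sum>k<d. y k i * y k j)"
    using psd_form_gram[OF _ psd_form_of_psd_mats[OF Y]] by auto
  let ?s = "\<lambda>k l. \<Sum>i<d. x k i * y l i"
  have "trace_inner X Y = (\<Sum>i<d. \<Sum>j<d. X $$ (i, j) * Y $$ (j, i))"
    using psd_matsD[OF X] psd_matsD[OF Y] by (simp add: trace_inner_eq_sum)
  also have "\<dots> = (\<Sum>i<d. \<Sum>j<d. \<Sum>k<d. \<Sum>l<d. (x k i * y l i) * (x k j * y l j))"
    by (intro sum.cong refl) (simp add: x y sum_product mult_ac)
  also have "\<dots> = (\<Sum>k<d. \<Sum>l<d. (?s k l)\<^sup>2)"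
    by (subst sum_swap4) (simp only: power2_eq_square sum_product)
  finally have tr: "trace_inner X Y = (\<Sum>k<d. \<Sum>l<d. (?s k l)\<^sup>2)" .
  show "0 \<le> trace_inner X Y"
    unfolding tr by (intro sum_nonneg) simp
  assume "trace_inner X Y = 0"
  then have s: "?s k l = 0" if "k < d" "l < d" for k l
    using that unfolding tr by (simp add: sum_nonneg_eq_0_iff sum_nonneg)
  show "X * Y = 0\<^sub>m d d"
  proof (rule eq_matI)
    fix i j assume "i < dim_row (0\<^sub>m d d :: real mat)" "j < dim_col (0\<^sub>m d d :: real mat)"
    then have ij: "i < d" "j < d" by auto
    have "(X * Y) $$ (i, j) = (\<Sum>m<d. X $$ (i, m) * Y $$ (m, j))"
      using psd_matsD(1)[OF X] psd_matsD(1)[OF Y] ij by (rule index_mult_mat_sum)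
    also have "\<dots> = (\<Sum>m<d. \<Sum>k<d. \<Sum>l<d. x k i * y l j * (x k m * y l m))"
      using ij by (intro sum.cong refl) (simp add: x y sum_product mult_ac)
    also have "\<dots> = (\<Sum>k<d. \<Sum>m<d. \<Sum>l<d. x k i * y l j * (x k m * y l m))"
      by (rule sum.swap)
    also have "\<dots> = (\<Sum>k<d. \<Sum>l<d. \<Sum>m<d. x k i * y l j * (x k m * y l m))"
      by (rule sum.cong[OF refl], rule sum.swap)
    also have "\<dots> = (\<Sum>k<d. \<Sum>l<d. x k i * y l j * ?s k l)"
      by (simp only: sum_distrib_left)
    also have "\<dots> = 0"
      using s by (intro sum.neutral ballI) simp
    finally show "(X * Y) $$ (i, j) = 0\<^sub>m d d $$ (i, j)"
      using ij by simp
  qed (use psd_matsD(1)[OF X] psd_matsD(1)[OF Y] in auto)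
qed

section \<open>Comparison matrices of cycles\<close>

lemma symmetric_mat_adjoint:
  fixes U :: "real mat"
  assumes "U \<in> carrier_mat d d" "transpose_mat U = U" "v \<in> carrier_vec d" "w \<in> carrier_vec d"
  shows "v \<bullet> (U *\<^sub>v w) = (U *\<^sub>v v) \<bullet> w"
  using transpose_vec_mult_scalar[OF assms(1,4,3)] assms(2) by simp

text \<open>\<open>U\<close> reflects the span of the first \<open>k\<close> columns. To pass to \<open>k + 1\<close>, compose it with the
  reflection along \<open>u = c + U c\<close>, twice the component of the new column \<open>c\<close> orthogonal to that span.\<close>

lemma ex_reflection_columns:
  fixes X :: "real mat"
  assumes X: "X \<in> carrier_mat d m"
  shows "\<exists>U \<in> carrier_mat d d. transpose_mat U = U \<and>
    (\<forall>w \<in> carrier_vec d. U *\<^sub>v (U *\<^sub>v w) = w) \<and>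
    (\<forall>j<k. U *\<^sub>v col X j = - col X j) \<and>
    (\<forall>w \<in> carrier_vec d. (\<forall>j<k. col X j \<bullet> w = 0) \<longrightarrow> U *\<^sub>v w = w)"
proof (induction k)
  case 0
  show ?case
    by (intro bexI[of _ "1\<^sub>m d"]) auto
next
  case (Suc k)
  then obtain U where U: "U \<in> carrier_mat d d" and sym: "transpose_mat U = U"
    and inv: "\<And>w. w \<in> carrier_vec d \<Longrightarrow> U *\<^sub>v (U *\<^sub>v w) = w"
    and neg: "\<And>j. j < k \<Longrightarrow> U *\<^sub>v col X j = - col X j"
    and fixed: "\<And>w. w \<in> carrier_vec d \<Longrightarrow> (\<And>j. j < k \<Longrightarrow> col X j \<bullet> w = 0) \<Longrightarrow> U *\<^sub>v w = w"
    by auto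
  note adj = symmetric_mat_adjoint[OF U sym]
  define c where "c = col X k"
  define u where "u = c + U *\<^sub>v c"
  have colX [simp]: "col X j \<in> carrier_vec d" for j
    using X by (auto simp: col_dim)
  have c [simp]: "c \<in> carrier_vec d"
    by (simp add: c_def)
  have Uv [simp]: "U *\<^sub>v w \<in> carrier_vec d" for w
    using U by (auto intro!: carrier_vecI)
  have u [simp]: "u \<in> carrier_vec d"
    by (simp add: u_def)
  have [simp]: "dim_vec c = d" "dim_vec u = d" "dim_row U = d" "dim_col U = d" "dim_row X = d"
    using carrier_vecD[OF c] carrier_vecD[OF u] carrier_matD[OF U] carrier_matD[OF X] by blast+
  \<comment> \<open>The involution \<open>U\<close> exchanges the two summands of
    \<open>u\<close>.\<close>
  have Uu: "U *\<^sub>v u = u"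
    unfolding u_def using inv U by (simp add: mult_add_distrib_mat_vec[of _ d d] comm_add_vec[of _ d])
  show ?case
  proof (cases "u = 0\<^sub>v d")
    case True
    have "U *\<^sub>v c = - c"
    proof (rule eq_vecI)
      fix i assume "i < dim_vec (- c)"
      then have i: "i < d" using c by auto
      have "u $ i = 0" using True i by simp
      moreover have "u $ i = c $ i + (U *\<^sub>v c) $ i"
        using i by (simp add: u_def del: index_mult_mat_vec)
      moreover have "(- c) $ i = - (c $ i)"
        using i by simp
      ultimately show "(U *\<^sub>v c) $ i = (- c) $ i"
        by simp
    qed simp
    then show ?thesis
      using U sym inv neg fixed unfolding c_def
      by (intro bexI[of _ U]) (auto simp: less_Suc_eq)
  next
    case False
    define t where "t = 2 / (u \<bullet> u)"
    have uu: "u \<bullet> u > 0"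
      using False conjugate_square_greater_0_vec[OF u] by simp
    have tuu: "t * (u \<bullet> u) = 2"
      using uu by (simp add: t_def)
    \<comment> \<open>Since \<open>U\<close> fixes \<open>u\<close>, this is the product of
      \<open>U\<close> with the Householder reflection along \<open>u\<close>, whose normalising
      factor is \<open>t\<close>.\<close>
    define V where "V = mat d d (\<lambda>(i, j). U $$ (i, j) - t * u $ i * u $ j)"
    have V: "V \<in> carrier_mat d d"
      by (simp add: V_def)
    have Usym: "U $$ (i, j) = U $$ (j, i)" if "i < d" "j < d" for i j
      using U sym that by (metis carrier_matD index_transpose_mat(1))
    have Vsym: "transpose_mat V = V"
      by (rule eq_matI) (auto simp: V_def Usym)
    have Vw: "V *\<^sub>v w = U *\<^sub>v w - (t * (u \<bullet> w)) \<cdot>\<^sub>v u" if w: "w \<in> carrier_vec d" for w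
    proof (rule eq_vecI)
      fix i assume "i < dim_vec (U *\<^sub>v w - (t * (u \<bullet> w)) \<cdot>\<^sub>v u)"
      then have i: "i < d" by simp
      show "(V *\<^sub>v w) $ i = (U *\<^sub>v w - (t * (u \<bullet> w)) \<cdot>\<^sub>v u) $ i"
        using i U V w
        by (simp add: V_def scalar_prod_def sum_subtractf sum_distrib_left sum_distrib_right algebra_simps)
    qed (use V U in simp)
    have "V *\<^sub>v (V *\<^sub>v w) = w" if w: "w \<in> carrier_vec d" for w
    proof -
      define a where "a = t * (u \<bullet> w)"
      have Vw': "V *\<^sub>v w = U *\<^sub>v w - a \<cdot>\<^sub>v u"
        using Vw[OF w] by (simp add: a_def)
      have "u \<bullet> (U *\<^sub>v w - a \<cdot>\<^sub>v u) = u \<bullet> w - a * (u \<bullet> u)"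
        using w adj[OF u w] Uu by (simp add: scalar_prod_minus_distrib[of _ d])
      then have "t * (u \<bullet> (U *\<^sub>v w - a \<cdot>\<^sub>v u)) = t * (u \<bullet> w) - a * (t * (u \<bullet> u))"
        by (simp only: right_diff_distrib mult.left_commute)
      then have 1: "t * (u \<bullet> (U *\<^sub>v w - a \<cdot>\<^sub>v u)) = - a"
        unfolding tuu a_def[symmetric] by simp
      have "U *\<^sub>v (U *\<^sub>v w - a \<cdot>\<^sub>v u) = w - a \<cdot>\<^sub>v u"
        using U w inv[OF w] Uu by (simp add: mult_minus_distrib_mat_vec[of _ d d] mult_mat_vec[of _ d d])
      then have "V *\<^sub>v (V *\<^sub>v w) = w - a \<cdot>\<^sub>v u - (- a) \<cdot>\<^sub>v u"
        unfolding Vw' using w by (subst Vw) (simp_all add: 1)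
      also have "\<dots> = w"
        using w by (intro eq_vecI) auto
      finally show ?thesis .
    qed
    moreover have "V *\<^sub>v col X j = - col X j" if "j < Suc k" for j
    proof (cases "j = k")
      case True
      \<comment> \<open>Both summands of \<open>u\<close> have the same inner product with
        \<open>u\<close>, so \<open>u \<bullet> c\<close> is half of
        \<open>u \<bullet> u\<close>.\<close>
      have "u \<bullet> u = u \<bullet> c + u \<bullet> (U *\<^sub>v c)"
        by (subst (2) u_def) (simp add: scalar_prod_add_distrib[of _ d])
      also have "u \<bullet> (U *\<^sub>v c) = u \<bullet> c"
        using adj[OF u c] Uu by simp
      finally have "t * (u \<bullet> c) = 1"
        using tuu by (simp add: algebra_simps)
      then have "V *\<^sub>v c = U *\<^sub>v c - u"
        using Vw[OF c] by simp
      also have "\<dots> = - c"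
        unfolding u_def by (intro eq_vecI) (auto simp del: index_mult_mat_vec)
      finally show ?thesis
        using True by (simp add: c_def)
    next
      case False
      then have j: "j < k" using that by simp
      \<comment> \<open>\<open>U\<close> fixes \<open>u\<close> but negates the earlier columns, so
        these are orthogonal to \<open>u\<close>.\<close>
      have "u \<bullet> col X j = - (u \<bullet> col X j)"
        using adj[OF u colX[of j]] Uu neg[OF j] by simp
      then have "u \<bullet> col X j = 0" by simp
      then show ?thesis
        using Vw[OF colX[of j]] neg[OF j]
        by (intro eq_vecI) auto
    qed
    moreover have "V *\<^sub>v w = w" if w: "w \<in> carrier_vec d" and 0: "\<forall>j<Suc k. col X j \<bullet> w = 0" for w
    proof -
      have Uw: "U *\<^sub>v w = w"
        using fixed[OF w] 0 by simp
      have "u \<bullet> w = c \<bullet> w + (U *\<^sub>v c) \<bullet> w"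
        unfolding u_def using w by (simp add: add_scalar_prod_distrib[of _ d])
      also have "(U *\<^sub>v c) \<bullet> w = c \<bullet> w"
        using adj[OF c w] Uw by simp
      also have "c \<bullet> w = 0"
        using 0 by (simp add: c_def)
      finally show ?thesis
        using Vw[OF w] Uw w by (intro eq_vecI) auto
    qed
    ultimately show ?thesis
      using V Vsym by (intro bexI[of _ V]) auto
  qed
qed

text \<open>All \<open>d\<close> columns of \<open>X\<close> are negated. As \<open>X\<close> is
  symmetric, \<open>X * Z = 0\<close> says that the columns of \<open>Z\<close> are orthogonal to
  them and hence fixed.\<close>

lemma ex_reflection:
  fixes X Z :: "real mat"
  assumes X: "X \<in> carrier_mat d d" "transpose_mat X = X" and Z: "Z \<in> carrier_mat d d"
    and XZ: "X * Z = 0\<^sub>m d d"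
  shows "\<exists>U \<in> carrier_mat d d. transpose_mat U = U \<and> U * U = 1\<^sub>m d \<and>
    U * X = (-1) \<cdot>\<^sub>m X \<and> U * Z = Z"
proof -
  obtain U where U: "U \<in> carrier_mat d d" and sym: "transpose_mat U = U"
    and inv: "\<And>w. w \<in> carrier_vec d \<Longrightarrow> U *\<^sub>v (U *\<^sub>v w) = w"
    and neg: "\<And>j. j < d \<Longrightarrow> U *\<^sub>v col X j = - col X j"
    and fixed: "\<And>w. w \<in> carrier_vec d \<Longrightarrow> (\<And>j. j < d \<Longrightarrow> col X j \<bullet> w = 0) \<Longrightarrow> U *\<^sub>v w = w"
    using ex_reflection_columns[OF X(1), of d] by auto
  have "col X j \<bullet> col Z i = 0" if "i < d" "j < d" for i j
  proof -
    have "col X j = row X j"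
      using X that by (metis carrier_matD(1) col_transpose)
    then have "col X j \<bullet> col Z i = (X * Z) $$ (j, i)"
      using X Z that by simp
    then show ?thesis using XZ that by simp
  qed
  then have UZ: "U *\<^sub>v col Z i = col Z i" if "i < d" for i
    using that Z by (intro fixed) auto
  have "U * U = 1\<^sub>m d"
  proof (rule mat_col_eqI)
    fix i assume "i < dim_col (1\<^sub>m d :: real mat)"
    then have i: "i < d" by simp
    have "col U i = U *\<^sub>v unit_vec d i"
      using U i by (intro eq_vecI) auto
    have "col (U * U) i = U *\<^sub>v (U *\<^sub>v unit_vec d i)"
      unfolding \<open>col U i = U *\<^sub>v unit_vec d i\<close>[symmetric] using U i by (rule col_mult2[OF U])
    also have "\<dots> = col (1\<^sub>m d) i"
      using i by (simp only: inv unit_vec_carrier col_one)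
    finally show "col (U * U) i = col (1\<^sub>m d) i" .
  qed (use U in auto)
  moreover have "U * X = (-1) \<cdot>\<^sub>m X"
  proof (rule mat_col_eqI)
    fix i assume "i < dim_col ((-1) \<cdot>\<^sub>m X)"
    then have i: "i < d" using X by simp
    then have "col (U * X) i = - col X i"
      by (simp only: col_mult2[OF U X(1)] neg)
    also have "\<dots> = col ((-1) \<cdot>\<^sub>m X) i"
      using X i by (intro eq_vecI) auto
    finally show "col (U * X) i = col ((-1) \<cdot>\<^sub>m X) i" .
  qed (use U X in auto)
  moreover have "U * Z = Z"
    using U Z by (intro mat_col_eqI) (auto simp: col_mult2[OF U Z] UZ simp del: col_mult)
  ultimately show ?thesis
    using U sym by blast
qed

section \<open>Signs along a cycle\<close>

definition cyclically_adjacent :: "nat \<Rightarrow> nat \<Rightarrow> nat \<Rightarrow> bool" where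
  "cyclically_adjacent n k l \<longleftrightarrow> l = Suc k mod n \<or> k = Suc l mod n"

text \<open>Signs alternating along the cycle realise the comparison matrix as a Gram matrix, except
  that in an odd cycle the signs clash at the vertex \<open>0\<close>. There \<open>X\<^sub>0\<close> is multiplied by a reflection
  that fixes \<open>X\<^sub>1\<close> and negates \<open>X\<^sub>n\<^sub>-\<^sub>1\<close>, which exists because \<open>X\<^sub>1 X\<^sub>n\<^sub>-\<^sub>1 = 0\<close>.\<close>

lemma psd_comparison_cycle:
  assumes n: "4 \<le> n" and X: "\<And>k. k < n \<Longrightarrow> X k \<in> psd_mats d"
    and nonadj: "\<And>k l. k < n \<Longrightarrow> l < n \<Longrightarrow> k \<noteq> l \<Longrightarrow> \<not> cyclically_adjacent n k l \<Longrightarrow>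
      trace_inner (X k) (X l) = 0"
  shows "psd_form {..<n} (comparison (\<lambda>k l. trace_inner (X k) (X l)))"
proof -
  let ?T = "\<lambda>k l. trace_inner (X k) (X l)"
  have Xc: "X k \<in> carrier_mat d d" and Xt: "transpose_mat (X k) = X k" if "k < n" for k
    using psd_matsD[OF X[OF that]] by auto
  have Xt_smult: "transpose_mat (a \<cdot>\<^sub>m X k) = a \<cdot>\<^sub>m X k" if "k < n" for a k
    using Xc[OF that] arg_cong[OF Xt[OF that], of "\<lambda>M. a \<cdot>\<^sub>m M"] by (auto simp: mat_eq_iff)
  \<comment> \<open>Covers both parities: for even \<open>n\<close> the identity serves as
    \<open>U\<close>, for odd \<open>n\<close> a reflection does.\<close>
  define s :: real where "s = (-1) ^ n"
  have "\<exists>U \<in> carrier_mat d d. transpose_mat U = U \<and> U * U = 1\<^sub>m d \<and>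
    U * X (n - 1) = s \<cdot>\<^sub>m X (n - 1) \<and> U * X 1 = X 1"
  proof (cases "even n")
    case True
    have "s \<cdot>\<^sub>m X (n - 1) = X (n - 1)"
      using True by (intro eq_matI) (auto simp: s_def)
    then show ?thesis
      using Xc[of 1] Xc[of "n - 1"] n by (intro bexI[of _ "1\<^sub>m d"]) auto
  next
    case False
    \<comment> \<open>Since \<open>4 \<le> n\<close>, the two neighbours of vertex 0 are not
      adjacent to each other; in a triangle they would be.\<close>
    have "\<not> cyclically_adjacent n (n - 1) 1"
      using n by (auto simp: cyclically_adjacent_def)
    then have "X (n - 1) * X 1 = 0\<^sub>m d d"
      using n by (intro mult_zero_of_trace_inner_zero X nonadj) auto
    then show ?thesis
      using ex_reflection[of "X (n - 1)" d "X 1"] Xc Xt n False by (auto simp: s_def)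
  qed
  then obtain U where U: "U \<in> carrier_mat d d" "transpose_mat U = U" "U * U = 1\<^sub>m d"
    and Un: "U * X (n - 1) = s \<cdot>\<^sub>m X (n - 1)" and U1: "U * X 1 = X 1"
    by blast
  \<comment> \<open>By cyclicity of the trace, \<open>U\<close> moves from \<open>X 0\<close> to
    \<open>X l\<close>, where it acts as a scalar.\<close>
  have U0: "trace_inner (U * X 0) (X l) = a * ?T 0 l"
    if l: "l < n" and Ul: "U * X l = a \<cdot>\<^sub>m X l" for l a
  proof -
    have 0: "0 < n" using n by simp
    have "X l * U = transpose_mat (U * X l)"
      using U Xc[OF l] Xt[OF l] by (simp add: transpose_mult[of _ d d])
    also have "\<dots> = a \<cdot>\<^sub>m X l"
      unfolding Ul using Xt_smult[OF l] .
    finally have XU: "X l * U = a \<cdot>\<^sub>m X l" .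
    have "trace_inner (U * X 0) (X l) = trace_inner (X l) (U * X 0)"
      using U Xc[OF l] Xc[OF 0] by (intro trace_inner_commute) auto
    also have "\<dots> = trace_inner (X l * U) (X 0)"
      unfolding trace_inner_def using U Xc[OF l] Xc[OF 0] by (simp add: assoc_mult_mat[of _ d d _ d _ d])
    also have "\<dots> = trace_inner (a \<cdot>\<^sub>m X l) (1 \<cdot>\<^sub>m X 0)"
      unfolding XU by (simp add: one_smult_mat)
    also have "\<dots> = a * ?T 0 l"
      using Xc[OF l] Xc[OF 0] trace_inner_commute[of "X l" d "X 0"] by (simp add: trace_inner_smult)
    finally show ?thesis .
  qed
  \<comment> \<open>\<open>U\<close> stands on the right so that the transpose of \<open>Y 0\<close>
    is \<open>U * X 0\<close>.\<close>
  define Y where "Y k = (if k = 0 then X 0 * U else (-1) ^ k \<cdot>\<^sub>m X k)" for k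
  let ?G = "\<lambda>k l. trace_inner (transpose_mat (Y k)) (Y l)"
  have Yc: "Y k \<in> carrier_mat d d" if "k < n" for k
    using Xc[OF that] U n by (auto simp: Y_def)
  have Y0: "transpose_mat (Y 0) = U * X 0"
    using U Xc[of 0] Xt[of 0] n by (simp add: Y_def transpose_mult[of _ d d])
  have psd: "psd_form {..<n} ?G"
    using Yc by (intro psd_form_gram_trace_inner) auto
  have G0: "?G 0 l = comparison ?T 0 l" if l: "l < n" for l
  proof -
    have 0: "0 < n" using n by simp
    consider "l = 0" | "l = 1" | "l = n - 1" "l \<noteq> 0" | "l \<noteq> 0" "\<not> cyclically_adjacent n 0 l"
      using l n by (cases "Suc l = n") (auto simp: cyclically_adjacent_def)
    then show ?thesis
    proof cases
      case 1
      \<comment> \<open>After commuting the factors, the two copies of \<open>U\<close> meet in the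
        middle and cancel.\<close>
      have "?G 0 0 = trace_inner (X 0 * U) (U * X 0)"
        unfolding Y0 using U Xc[OF 0] by (simp add: Y_def trace_inner_commute[of _ d])
      also have "X 0 * U * (U * X 0) = X 0 * (U * U * X 0)"
        using U(1) Xc[OF 0] by (simp add: assoc_mult_mat[of _ d d _ d _ d])
      then have "trace_inner (X 0 * U) (U * X 0) = ?T 0 0"
        using U(3) Xc[OF 0] by (simp add: trace_inner_def)
      finally show ?thesis
        using 1 by (simp add: comparison_def)
    next
      case 2
      have "?G 0 1 = trace_inner (1 \<cdot>\<^sub>m (U * X 0)) ((-1) \<cdot>\<^sub>m X 1)"
        unfolding Y0 by (simp add: Y_def one_smult_mat)
      also have "\<dots> = - trace_inner (U * X 0) (X 1)"
        using U Xc[of 0] Xc[of 1] n by (subst trace_inner_smult[of _ d]) auto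
      also have "trace_inner (U * X 0) (X 1) = ?T 0 1"
        using U0[of 1 1] U1 n by (simp add: one_smult_mat)
      finally show ?thesis
        using 2 by (simp add: comparison_def)
    next
      case 3
      have "?G 0 l = trace_inner (1 \<cdot>\<^sub>m (U * X 0)) ((-1) ^ l \<cdot>\<^sub>m X l)"
        unfolding Y0 using 3 by (simp add: Y_def one_smult_mat)
      also have "\<dots> = (-1) ^ l * trace_inner (U * X 0) (X l)"
        using U Xc[OF 0] Xc[OF l] by (subst trace_inner_smult[of _ d]) auto
      also have "trace_inner (U * X 0) (X l) = s * ?T 0 l"
        using U0[OF l] Un 3 by simp
      \<comment> \<open>Here \<open>l = n - 1\<close>, so the exponents \<open>l\<close> and
        \<open>n\<close> differ in parity.\<close>
      also have "(-1) ^ l * (s * ?T 0 l) = - ?T 0 l"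
      proof -
        obtain m where "n = Suc m" using n by (cases n) auto
        then show ?thesis using 3 by (simp add: s_def flip: power_mult_distrib mult.assoc)
      qed
      finally show ?thesis
        using 3 by (simp add: comparison_def)
    next
      case 4
      have T: "?T 0 l = 0"
        using nonadj[OF 0 l] 4 by simp
      \<comment> \<open>\<open>U * X 0\<close> need not be positive semidefinite; what carries over
        to it is the vanishing of the product, not merely of the trace.\<close>
      then have "X 0 * X l = 0\<^sub>m d d"
        using X 0 l by (intro mult_zero_of_trace_inner_zero) auto
      then have "U * X 0 * X l = 0\<^sub>m d d"
        using U Xc[OF 0] Xc[OF l] by (simp add: assoc_mult_mat[of _ d d _ d _ d])
      then have "trace_inner (U * X 0) (X l) = 0"
        by (simp add: trace_inner_def mat_trace_def)
      moreover have "?G 0 l = trace_inner (1 \<cdot>\<^sub>m (U * X 0)) ((-1) ^ l \<cdot>\<^sub>m X l)"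
        unfolding Y0 using 4 by (simp add: Y_def one_smult_mat)
      ultimately have "?G 0 l = 0"
        using U Xc[OF 0] Xc[OF l] by (simp add: trace_inner_smult[of _ d])
      then show ?thesis
        using T 4 by (simp add: comparison_def)
    qed
  qed
  have Gpos: "?G k l = comparison ?T k l" if kl: "k < n" "l < n" "k \<noteq> 0" "l \<noteq> 0" for k l
  proof -
    have "?G k l = trace_inner ((-1) ^ k \<cdot>\<^sub>m X k) ((-1) ^ l \<cdot>\<^sub>m X l)"
      using kl Xt_smult[OF kl(1)] by (simp add: Y_def)
    also have "\<dots> = (-1) ^ (k + l) * ?T k l"
      using trace_inner_smult[OF Xc[OF kl(1)] Xc[OF kl(2)]] by (simp add: power_add)
    also have "\<dots> = comparison ?T k l"
    proof -
      \<comment> \<open>Away from vertex 0, adjacent vertices have consecutive numbers, whose sum is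
        odd.\<close>
      consider "k = l" | "k \<noteq> l" "\<not> cyclically_adjacent n k l" | "l = Suc k" | "k = Suc l"
        using kl by (cases "Suc k = n"; cases "Suc l = n") (auto simp: cyclically_adjacent_def)
      then show ?thesis
        using nonadj[of k l] kl by cases (auto simp: comparison_def)
    qed
    finally show ?thesis .
  qed
  have "?G k l = comparison ?T k l" if "k \<in> {..<n}" "l \<in> {..<n}" for k l
  proof (cases "l = 0")
    case True
    have "?G k 0 = ?G 0 k"
      using psd_form_sym[OF psd that(1), of 0] n by simp
    also have "\<dots> = comparison ?T 0 k"
      using G0 that by simp
    also have "\<dots> = comparison ?T k 0"
      using trace_inner_commute[of "X 0" d "X k"] Xc that n by (simp add: comparison_def)
    finally show ?thesis
      using True by simp
  next
    case False
    then show ?thesis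
      using G0 Gpos that by (cases "k = 0") auto
  qed
  then show ?thesis
    using psd_form_cong[of "{..<n}" ?G "comparison ?T"] psd by blast
qed

section \<open>Completely positive semidefinite matrices of cycles\<close>

lemma completely_positive_of_cp_form:
  assumes A: "A \<in> sym_mats n" and cp: "cp_form {..<n} (\<lambda>i j. A $$ (i, j))"
  shows "A \<in> completely_positive n"
proof -
  obtain m :: nat and y where y: "\<And>k i. k < m \<Longrightarrow> i \<in> {..<n} \<Longrightarrow> 0 \<le> y k i"
      "\<And>i j. i \<in> {..<n} \<Longrightarrow> j \<in> {..<n} \<Longrightarrow> A $$ (i, j) = (\<Sum>k<m. y k i * y k j)"
    using cp_formE[OF cp] by metis
  \<comment> \<open>a zero coordinate is appended because the dimension must be positive\<close>
  define x where "x i = vec (Suc m) (\<lambda>k. if k < m then y k i else 0)" for i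
  have "x i \<in> nonneg_vecs (Suc m)" if "i < n" for i
    using y(1) that by (auto simp: x_def nonneg_vecs_def)
  moreover have "A $$ (i, j) = x i \<bullet> x j" if "i < n" "j < n" for i j
    using y(2) that by (simp add: x_def scalar_prod_def atLeast0LessThan)
  ultimately show ?thesis
    using A unfolding completely_positive_def by (auto intro!: exI[of _ "Suc m"] exI[of _ x])
qed

text \<open>Diagonal matrices carrying the entries of \<open>x i\<close> are positive semidefinite
  and have the same inner products.\<close>

lemma cs_plus_of_completely_positive:
  assumes "A \<in> completely_positive n"
  shows "A \<in> cs_plus n"
proof -
  obtain d x where A: "A \<in> sym_mats n" and d: "1 \<le> d"
    and x: "\<And>i. i < n \<Longrightarrow> x i \<in> nonneg_vecs d"
    and eq: "\<And>i j. i < n \<Longrightarrow> j < n \<Longrightarrow> A $$ (i, j) = x i \<bullet> x j"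
    using assms unfolding completely_positive_def by blast
  define X where "X i = mat d d (\<lambda>(a, b). if a = b then x i $ a else 0)" for i
  have Xc: "X i \<in> carrier_mat d d" for i
    by (simp add: X_def)
  have dim: "dim_vec (x i) = d" if "i < n" for i
    using x[OF that] by (auto simp: nonneg_vecs_def)
  have "X i \<in> psd_mats d" if "i < n" for i
  proof -
    have "transpose_mat (X i) = X i"
      by (rule eq_matI) (auto simp: X_def)
    moreover have "0 \<le> v \<bullet> (X i *\<^sub>v v)" if v: "v \<in> carrier_vec d" for v
    proof -
      have "v \<bullet> (X i *\<^sub>v v) = (\<Sum>a<d. v $ a * (\<Sum>b<d. (if a = b then x i $ a else 0) * v $ b))"
        using v by (simp add: X_def scalar_prod_def atLeast0LessThan)
      also have "\<dots> = (\<Sum>a<d. x i $ a * (v $ a * v $ a))"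
      proof (intro sum.cong refl)
        fix a assume "a \<in> {..<d}"
        then have "(\<Sum>b<d. (if a = b then x i $ a else 0) * v $ b) = x i $ a * v $ a"
          by (subst sum.remove[of _ a]) (auto intro!: sum.neutral)
        then show "v $ a * (\<Sum>b<d. (if a = b then x i $ a else 0) * v $ b) = x i $ a * (v $ a * v $ a)"
          by simp
      qed
      also have "\<dots> \<ge> 0"
        using x[OF \<open>i < n\<close>] by (intro sum_nonneg) (auto simp: nonneg_vecs_def)
      finally show ?thesis .
    qed
    ultimately show ?thesis
      using Xc by (simp add: psd_mats_def sym_mats_def)
  qed
  moreover have "A $$ (i, j) = trace_inner (X i) (X j)" if "i < n" "j < n" for i j
  proof -
    have "trace_inner (X i) (X j) = (\<Sum>a<d. \<Sum>b<d. if a = b then x i $ a * x j $ b else 0)"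
      unfolding trace_inner_eq_sum[OF Xc Xc] by (intro sum.cong refl) (auto simp: X_def)
    then show ?thesis
      using eq[OF that] dim[OF that(2)] by (simp add: scalar_prod_def atLeast0LessThan)
  qed
  ultimately show ?thesis
    using A d unfolding cs_plus_def by blast
qed

text \<open>\<open>h\<close> turns positions along the cycle into vertices. A nonzero entry at
  distinct nonadjacent positions would be a chord, which the edge set excludes.\<close>

lemma cycle_graph_enumeration:
  assumes "is_cycle_graph (support_graph n A)"
  obtains h where "3 \<le> n" "bij_betw h {..<n} {..<n}"
    "\<And>k l. k < n \<Longrightarrow> l < n \<Longrightarrow> k \<noteq> l \<Longrightarrow> \<not> cyclically_adjacent n k l \<Longrightarrow> A $$ (h k, h l) = 0"
proof -
  obtain vs where vs: "3 \<le> length vs" "distinct vs" "{0..<n} = set vs"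
    and edges: "{{i, j} | i j. i < n \<and> j < n \<and> i \<noteq> j \<and> A $$ (i, j) \<noteq> 0}
      = {{vs ! k, vs ! (Suc k mod length vs)} | k. k < length vs}"
    using assms unfolding is_cycle_graph_def support_graph_def by auto
  have len: "length vs = n"
    using distinct_card[OF vs(2)] vs(3) by (metis card_atLeastLessThan diff_zero)
  have bij: "bij_betw ((!) vs) {..<n} {..<n}"
    using bij_betw_nth[OF vs(2)] vs(3) len by (simp add: atLeast0LessThan)
  have "A $$ (vs ! k, vs ! l) = 0" if kl: "k < n" "l < n" "k \<noteq> l" "\<not> cyclically_adjacent n k l" for k l
  proof (rule ccontr)
    assume "A $$ (vs ! k, vs ! l) \<noteq> 0"
    moreover have "vs ! k < n" "vs ! l < n" "vs ! k \<noteq> vs ! l"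
      using kl vs len bij by (auto simp: nth_eq_iff_index_eq bij_betw_def)
    ultimately have "{vs ! k, vs ! l} \<in> {{vs ! k, vs ! (Suc k mod length vs)} | k. k < length vs}"
      unfolding edges[symmetric] by blast
    then obtain m where m: "m < n" "{vs ! k, vs ! l} = {vs ! m, vs ! (Suc m mod n)}"
      unfolding len by blast
    have "Suc m mod n < n" using m by simp
    \<comment> \<open>Distinctness of \<open>vs\<close> lets equal edges be read as equal pairs of
      positions.\<close>
    then have "{k, l} = {m, Suc m mod n}"
      using m kl vs(2) len by (auto simp: doubleton_eq_iff nth_eq_iff_index_eq)
    then show False
      using kl(4) by (auto simp: doubleton_eq_iff cyclically_adjacent_def)
  qed
  then show ?thesis
    using that bij vs(1) len by metis
qed

theorem theorem3p7:
  fixes n :: nat and A :: "real mat"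
  assumes "A \<in> sym_mats n"
    and "is_cycle_graph (support_graph n A)"
  shows "A \<in> cs_plus n \<longleftrightarrow> A \<in> completely_positive n"
proof
  assume "A \<in> cs_plus n"
  then obtain d X where X: "\<And>i. i < n \<Longrightarrow> X i \<in> psd_mats d"
    and eq: "\<And>i j. i < n \<Longrightarrow> j < n \<Longrightarrow> A $$ (i, j) = trace_inner (X i) (X j)"
    unfolding cs_plus_def by blast
  obtain h where n: "3 \<le> n" and h: "bij_betw h {..<n} {..<n}"
    and nonadj: "\<And>k l. k < n \<Longrightarrow> l < n \<Longrightarrow> k \<noteq> l \<Longrightarrow> \<not> cyclically_adjacent n k l \<Longrightarrow> A $$ (h k, h l) = 0"
    using cycle_graph_enumeration[OF assms(2)] by metis
  let ?Q = "\<lambda>i j. A $$ (i, j)"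
  have nonneg: "0 \<le> ?Q i j" if "i \<in> {..<n}" "j \<in> {..<n}" for i j
    using eq trace_inner_nonneg[OF X X] that by simp
  have "cp_form {..<n} ?Q"
  proof (cases "n = 3")
    case True
    then have I: "{..<n} = {0, 1, 2}" by auto
    have "psd_form {..<n} (\<lambda>i j. trace_inner (transpose_mat (X i)) (X j))"
      using psd_matsD(1)[OF X] by (intro psd_form_gram_trace_inner) auto
    then have "psd_form {..<n} ?Q"
      using psd_form_cong[of "{..<n}" ?Q "\<lambda>i j. trace_inner (transpose_mat (X i)) (X j)"]
        psd_matsD(2)[OF X] eq by simp
    then show ?thesis
      using nonneg unfolding I by (rule cp_form_dim3)
  next
    case False
    have hn: "h k < n" if "k < n" for k
      using h that by (auto simp: bij_betw_def)
    let ?T = "\<lambda>k l. trace_inner (X (h k)) (X (h l))"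
    have "psd_form {..<n} (comparison ?T)"
    proof (rule psd_comparison_cycle)
      show "4 \<le> n" using n False by simp
    qed (use X hn nonadj eq in auto)
    \<comment> \<open>\<open>comparison\<close> only tests indices for equality, so it commutes with
      the injective relabelling \<open>h\<close>.\<close>
    moreover have "comparison ?T k l = comparison ?Q (h k) (h l)" if "k \<in> {..<n}" "l \<in> {..<n}" for k l
      using that eq hn h by (auto simp: comparison_def bij_betw_def inj_on_def)
    ultimately have "psd_form {..<n} (\<lambda>k l. comparison ?Q (h k) (h l))"
      using psd_form_cong[of "{..<n}" "comparison ?T" "\<lambda>k l. comparison ?Q (h k) (h l)"] by blast
    then have "psd_form {..<n} (comparison ?Q)"
      by (rule psd_form_reindex[OF h])
    then show ?thesis
      using nonneg by (intro cp_form_of_psd_comparison) auto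
  qed
  then show "A \<in> completely_positive n"
    using assms(1) by (rule completely_positive_of_cp_form[rotated])
qed (rule cs_plus_of_completely_positive)

end
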